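(* Let $G\subset\mathbb{Z}\times\mathbb{Z}^n$ be a graded semigroup which can be approximated by a semigroup of type $(C,T,A)$. Let $f:\mathbb{R}^n\to\mathbb{R}$ be a $C^1$ homogeneous function of degree $\alpha\ge0$ (i.e. $f(\lambda x)=\lambda^\alpha f(x)$ for $\lambda>0$). Then $$\lim_{d\to\infty}\frac{\sum_{x\in G(d)}f(x)}{d^{\alpha+n}}=\frac{1}{\mathrm{ind}(T)}\int_{\Delta(G)}f(x)\,dx,$$ where $\mathrm{ind}(T)$ is the index of the subgroup $T\subset\mathbb{Z}^n$, $G(d)$ is the set of elements of degree $d$ in $G$ (regarded as a set of points $x\in\mathbb{Z}^n$ with $(d,x)\in G$), and $\Delta(G)$ is the Newton convex body of $G$.
   Context: Write points of $\mathbb{R}\times\mathbb{R}^n$ as $(h,\mathbf{x})$. A graded semigroup is a semigroup $G\subset\mathbb{Z}\times\mathbb{Z}^n$ contained in the half-space $h\ge0$ such that for each $d\in\mathbb{N}$ (positive integers) the set $G(d)$ of elements of $G$ with first coordinate $d$ ("of degree $d$") is non-empty. A positive cone is a closed convex $(n+1)$-dimensional cone $C$ (with apex at the origin) in the half-space $h\ge0$ with $C\cap\{h=0\}=\{0\}$. Let $C$ be a positive cone, $T\subset\mathbb{Z}^n=\{0\}\times\mathbb{Z}^n$ a subgroup of finite index, and $A\in\{1\}\times\mathbb{Z}^n$. The semigroup of type $(C,T,A)$ is $C\cap\{lA+t: l\in\mathbb{Z},\,t\in T\}$. A semigroup $M$ of type $(C,T,A)$ approximates $G$ if $G\subseteq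 M$ and $\lim_{d\to\infty} r_{G,M}(d)/d=0$, where, with $M(d),G(d),C(d)$ the sections by the hyperplane $h=d$, $r_{G,M}(d)$ is the maximum distance from a point of $M(d)\setminus G(d)$ to the boundary of $C(d)$ (boundary taken in the hyperplane $h=d$; $r_{G,M}(d)=0$ if $M(d)\setminus G(d)$ is empty). If $G$ is approximated by a semigroup of type $(C,T,A)$, its Newton convex body $\Delta(G)$ is the intersection of $C$ with the hyperplane $h=1$, regarded as a subset of $\mathbb{R}^n$. *)

theory Defs
  imports "HOL-Analysis.Analysis" "HOL-Algebra.Coset"
begin

definition vec_real :: "int ^ 'n \<Rightarrow> real ^ 'n" where
  "vec_real x = (\<chi> i. real_of_int (x $ i))"

definition slice :: "('a \<times> 'b) set \<Rightarrow> 'a \<Rightarrow> 'b set" where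
  "slice X h = {x. (h, x) \<in> X}"

definition graded_semigroup :: "(int \<times> (int ^ 'n)) set \<Rightarrow> bool" where
  "graded_semigroup G \<longleftrightarrow>
     (\<forall>x\<in>G. \<forall>y\<in>G. x + y \<in> G) \<and>
     (\<forall>x\<in>G. fst x \<ge> 0) \<and>
     (\<forall>d>0. slice G d \<noteq> {})"

definition positive_cone :: "(real \<times> (real ^ 'n)) set \<Rightarrow> bool" where
  "positive_cone C \<longleftrightarrow>
     closed C \<and> convex C \<and> cone C \<and>
     aff_dim C = int (CARD('n)) + 1 \<and>
     (\<forall>z\<in>C. fst z \<ge> 0) \<and>
     C \<inter> {z. fst z = 0} = {0}"

definition lattice_group :: "(int ^ 'n) monoid" where
  "lattice_group = \<lparr>carrier = UNIV, monoid.mult = (+), one = 0\<rparr>"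

lemma comm_group_lattice_group: "comm_group (lattice_group :: (int ^ 'n) monoid)"
proof (rule comm_groupI)
  fix x :: "int ^ 'n"
  assume "x \<in> carrier lattice_group"
  show "\<exists>y\<in>carrier lattice_group. y \<otimes>\<^bsub>lattice_group\<^esub> x = \<one>\<^bsub>lattice_group\<^esub>"
    by (rule bexI[of _ "- x"]) (simp_all add: lattice_group_def)
qed (simp_all add: lattice_group_def algebra_simps)

definition finite_index_subgroup :: "(int ^ 'n) set \<Rightarrow> bool" where
  "finite_index_subgroup T \<longleftrightarrow>
     subgroup T lattice_group \<and> finite (rcosets\<^bsub>lattice_group\<^esub> T)"

definition ind :: "(int ^ 'n) set \<Rightarrow> nat" where
  "ind T = card (rcosets\<^bsub>lattice_group\<^esub> T)"

definition type_semigroup ::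
  "(real \<times> (real ^ 'n)) set \<Rightarrow> (int ^ 'n) set \<Rightarrow> int \<times> (int ^ 'n) \<Rightarrow> (int \<times> (int ^ 'n)) set" where
  "type_semigroup C T A =
     {z. (real_of_int (fst z), vec_real (snd z)) \<in> C \<and>
         (\<exists>l. \<exists>t\<in>T. z = (l * fst A, l *s snd A) + (0, t))}"

(* For d > 0 and a positive cone C the slice of C is compact with non-empty interior, so its
   frontier (taken in the hyperplane h = d) is non-empty; type_semigroup C T A has finite slices,
   so Max is a genuine maximum for M = type_semigroup C T A. *)
definition approx_defect ::
  "(real \<times> (real ^ 'n)) set \<Rightarrow> (int \<times> (int ^ 'n)) set \<Rightarrow> (int \<times> (int ^ 'n)) set \<Rightarrow> nat \<Rightarrow> real" where
  "approx_defect C M G d =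
     (if slice M (int d) - slice G (int d) = {} then 0
      else Max ((\<lambda>x. infdist (vec_real x) (frontier (slice C (real d)))) `
                (slice M (int d) - slice G (int d))))"

definition approximated_by_type ::
  "(int \<times> (int ^ 'n)) set \<Rightarrow> (real \<times> (real ^ 'n)) set \<Rightarrow> (int ^ 'n) set \<Rightarrow> int \<times> (int ^ 'n) \<Rightarrow> bool" where
  "approximated_by_type G C T A \<longleftrightarrow>
     positive_cone C \<and> finite_index_subgroup T \<and> fst A = 1 \<and>
     G \<subseteq> type_semigroup C T A \<and>
     (\<lambda>d. approx_defect C (type_semigroup C T A) G d / real d) \<longlonglongrightarrow> 0"

(* The Newton convex body of every G approximated by a semigroup of type (C, T, A);
   it depends on G only through the approximating cone C. *)
definition newton_body :: "(real \<times> (real ^ 'n)) set \<Rightarrow> (real ^ 'n) set" where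
  "newton_body C = slice C 1"

definition C1_function :: "('a::real_normed_vector \<Rightarrow> 'b::real_normed_vector) \<Rightarrow> bool" where
  "C1_function f \<longleftrightarrow>
     (\<exists>f' :: 'a \<Rightarrow> 'a \<Rightarrow>\<^sub>L 'b.
        (\<forall>x. (f has_derivative blinfun_apply (f' x)) (at x)) \<and> continuous_on UNIV f')"

definition homogeneous_of_degree :: "real \<Rightarrow> ('a::real_vector \<Rightarrow> real) \<Rightarrow> bool" where
  "homogeneous_of_degree \<alpha> f \<longleftrightarrow> (\<forall>c>0. \<forall>x. f (c *\<^sub>R x) = c powr \<alpha> * f x)"

end

(*
  The cells of side 1/d indexed by Z^n are grouped by the lattice point x of dA + T obtained by
  subtracting a representative of a class of Z^n/T; each x then owns ind(T) cells, so the sum over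
  G(d), rescaled by homogeneity, is 1/ind(T) times the integral of a step function.  At an interior
  point of the Newton body the defect condition makes these step functions converge to f, outside
  the body they vanish eventually, and the boundary of a convex set is negligible; so dominated
  convergence applies.
*)
theory Submission
  imports Defs
begin

section \<open>Lattice points and cubic cells of side 1/d\<close>

lemma vec_real_nth [simp]: "vec_real x $ i = real_of_int (x $ i)"
  by (simp add: vec_real_def)

lemma vec_real_add: "vec_real (x + y) = vec_real x + vec_real y"
  by (simp add: vec_eq_iff)

lemma finite_bounded_vec_real:
  assumes "bounded S"
  shows "finite {x :: int ^ 'n. vec_real x \<in> S}"
proof -
  obtain B where B: "\<And>y. y \<in> S \<Longrightarrow> norm y \<le> B"
    using assms by (auto simp: bounded_iff)
  let ?F = "(UNIV :: 'n set) \<rightarrow>\<^sub>E {- \<lceil>B\<rceil>..\<lceil>B\<rceil>}"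
  have "{x :: int ^ 'n. vec_real x \<in> S} \<subseteq> vec_lambda ` ?F"
  proof
    fix x :: "int ^ 'n"
    assume "x \<in> {x. vec_real x \<in> S}"
    then have "\<bar>x $ i\<bar> \<le> \<lceil>B\<rceil>" for i
      using B[of "vec_real x"] component_le_norm_cart[of "vec_real x" i] by simp linarith
    then have "vec_nth x \<in> ?F"
      by (auto simp: abs_le_iff minus_le_iff)
    then show "x \<in> vec_lambda ` ?F"
      by (metis imageI vec_nth_inverse)
  qed
  moreover have "finite ?F"
    by (intro finite_PiE) auto
  ultimately show ?thesis
    by (meson finite_imageI finite_subset)
qed

text \<open>For d > 0 this is the half-open cube with corner w/d and side 1/d. The floor encoding
  puts every point into exactly one cell for each d.\<close>

definition cell :: "real \<Rightarrow> int ^ 'n \<Rightarrow> (real ^ 'n) set" where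
  "cell d w = {y. \<forall>i. \<lfloor>d * y $ i\<rfloor> = w $ i}"

text \<open>Every coordinate of the difference is a fractional part. The l1 bound is crude, but it
  does not depend on d, which is all that the limit requires.\<close>

lemma norm_cell_le:
  assumes "y \<in> cell d w"
  shows "norm (d *\<^sub>R y - vec_real (w :: int ^ 'n)) \<le> real CARD('n)"
proof -
  have "norm (d *\<^sub>R y - vec_real w) \<le> (\<Sum>i\<in>UNIV. \<bar>(d *\<^sub>R y - vec_real w) $ i\<bar>)"
    by (rule norm_le_l1_cart)
  also have "\<dots> \<le> (\<Sum>i\<in>(UNIV::'n set). 1)"
  proof (rule sum_mono)
    fix i
    have "\<lfloor>d * y $ i\<rfloor> = w $ i"
      using assms by (simp add: cell_def)
    then show "\<bar>(d *\<^sub>R y - vec_real w) $ i\<bar> \<le> 1"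
      by simp linarith
  qed
  finally show ?thesis by simp
qed

text \<open>The cell lies between an open box and its closure, which differ by a negligible set, so
  its integral is the volume of the box.\<close>

lemma has_integral_indicator_cell:
  assumes "d > 0"
  shows "(indicat_real (cell d (w :: int ^ 'n)) has_integral 1 / d ^ CARD('n)) UNIV"
proof -
  define a b :: "real ^ 'n" where
    "a = (1 / d) *\<^sub>R vec_real w" and "b = (1 / d) *\<^sub>R vec_real (w + 1)"
  have "((\<lambda>_. 1 :: real) has_integral measure lborel (cbox a b) *\<^sub>R 1) (cbox a b)"
    by (rule has_integral_const)
  moreover have "measure lborel (cbox a b) = 1 / d ^ CARD('n)"
  proof -
    have "measure lborel (cbox a b) = (\<Prod>i\<in>UNIV. b $ i - a $ i)"
      using assms by (intro content_cbox_cart) (auto simp: interval_ne_empty_cart a_def b_def field_simps)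
    also have "\<dots> = (\<Prod>i\<in>(UNIV :: 'n set). 1 / d)"
      using assms by (intro prod.cong) (auto simp: a_def b_def field_simps)
    finally show ?thesis by (simp add: power_divide)
  qed
  ultimately have *: "((\<lambda>y. if y \<in> cbox a b then 1 else 0 :: real) has_integral 1 / d ^ CARD('n)) UNIV"
    by (simp only: has_integral_restrict_UNIV) simp
  have scale: "real_of_int k / d \<le> t \<longleftrightarrow> real_of_int k \<le> d * t"
    "t < real_of_int k / d \<longleftrightarrow> d * t < real_of_int k"
    "real_of_int k / d < t \<longleftrightarrow> real_of_int k < d * t"
    "t \<le> real_of_int k / d \<longleftrightarrow> d * t \<le> real_of_int k" for k t
    using assms by (auto simp: field_simps)
  have "cell d w \<subseteq> cbox a b"
  proof
    fix y assume "y \<in> cell d w"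
    then have "real_of_int (w $ i) \<le> d * y $ i \<and> d * y $ i \<le> real_of_int ((w + 1) $ i)" for i
      unfolding cell_def by simp (metis add.commute floor_correct less_eq_real_def of_int_1 of_int_add)
    then show "y \<in> cbox a b"
      by (simp add: mem_box_cart a_def b_def scale del: vector_add_component of_int_add)
  qed
  moreover have "box a b \<subseteq> cell d w"
  proof
    fix y assume "y \<in> box a b"
    then have "real_of_int (w $ i) < d * y $ i \<and> d * y $ i < real_of_int ((w + 1) $ i)" for i
      by (simp add: mem_box_cart a_def b_def scale del: vector_add_component of_int_add)
    then show "y \<in> cell d w"
      unfolding cell_def by (auto intro!: floor_unique order.strict_implies_order)
  qed
  ultimately show ?thesis
    by (intro has_integral_spike[OF negligible_frontier_interval[of a b] _ *])
       (auto simp: indicator_def)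
qed

section \<open>Limits of rescaled sums over cosets\<close>

text \<open>A Riemann-sum argument that isolates the analysis from cones and semigroups. In
  \<open>fills\<close> both the radius and the threshold for d may depend on y: dominated
  convergence asks only for pointwise limits.\<close>

lemma lattice_sum_tendsto_integral:
  fixes K :: "(real ^ 'n) set" and T R :: "(int ^ 'n) set" and v :: "nat \<Rightarrow> int ^ 'n"
    and X :: "nat \<Rightarrow> (int ^ 'n) set" and f :: "real ^ 'n \<Rightarrow> real"
  assumes "compact K" and negl: "negligible (frontier K)" and contf: "continuous_on UNIV f"
    and "finite R"
    and transversal: "\<And>w. \<exists>!c. c \<in> R \<and> w - c \<in> T"
    and coset: "\<And>d x. x \<in> X d \<Longrightarrow> x - v d \<in> T"
    and inK: "\<And>d x. d > 0 \<Longrightarrow> x \<in> X d \<Longrightarrow> (1 / real d) *\<^sub>R vec_real x \<in> K"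
    and fills: "\<And>y. y \<in> interior K \<Longrightarrow>
      \<exists>\<epsilon>>0. \<forall>\<^sub>F d in sequentially. \<forall>x. x - v d \<in> T \<and> dist ((1 / real d) *\<^sub>R vec_real x) y < \<epsilon> \<longrightarrow> x \<in> X d"
  shows "(\<lambda>d. (\<Sum>x\<in>X d. f ((1 / real d) *\<^sub>R vec_real x)) / real d ^ CARD('n))
           \<longlonglongrightarrow> 1 / real (card R) * integral K f"
proof -
  let ?p = "\<lambda>d x. (1 / real d) *\<^sub>R vec_real x :: real ^ 'n"
  \<comment> \<open>The step function with value f(x/d) on each of the cells x + c owned by x;
    \<open>g_eq\<close> shows that for d > 0 these cells do not overlap.\<close>
  define g where
    "g d y = (\<Sum>x\<in>X d. \<Sum>c\<in>R. f (?p d x) * indicator (cell (real d) (x + c)) y)" for d y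
  have "bounded K" and "closed K"
    using \<open>compact K\<close> by (auto simp: compact_imp_bounded compact_imp_closed)
  have finX: "finite (X d)" if "d > 0" for d
  proof -
    have "bounded ((\<lambda>y. real d *\<^sub>R y) ` K)"
      using \<open>bounded K\<close> by (rule bounded_scaling)
    moreover have "vec_real x \<in> (\<lambda>y. real d *\<^sub>R y) ` K" if "x \<in> X d" for x
      using inK[OF \<open>d > 0\<close> that] \<open>d > 0\<close> by (auto intro!: image_eqI[where x = "?p d x"])
    ultimately show ?thesis
      by (auto intro: finite_subset[OF _ finite_bounded_vec_real])
  qed
  \<comment> \<open>For y in a cell owned by x, the point d y is within L of x: the dimension
    accounts for the size of the cell, the norm of c for the offset by the representative. Summing
    the norms over \<open>R\<close> bounds all of them at once.\<close>
  obtain L where L: "\<And>c. c \<in> R \<Longrightarrow> real CARD('n) + norm (vec_real c) \<le> L" "L \<ge> 0"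
  proof
    show "real CARD('n) + norm (vec_real c) \<le> real CARD('n) + (\<Sum>c\<in>R. norm (vec_real c))" if "c \<in> R" for c
      using member_le_sum[OF that, of "\<lambda>c. norm (vec_real c)"] \<open>finite R\<close> by simp
  qed (simp add: sum_nonneg)
  have near: "dist (?p d x) y \<le> L / real d" if "d > 0" "c \<in> R" "y \<in> cell (real d) (x + c)" for d x c y
  proof -
    have "real d * dist (?p d x) y = norm (real d *\<^sub>R y - vec_real x)"
    proof -
      have "real d *\<^sub>R (y - ?p d x) = real d *\<^sub>R y - vec_real x"
        using \<open>d > 0\<close> by (simp add: scaleR_diff_right)
      then show ?thesis
        by (metis abs_of_nat dist_commute dist_norm norm_scaleR)
    qed
    also have "\<dots> \<le> norm (real d *\<^sub>R y - vec_real (x + c)) + norm (vec_real c)"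
      using norm_triangle_ineq[of "real d *\<^sub>R y - vec_real (x + c)" "vec_real c"]
      by (simp add: vec_real_add)
    also have "\<dots> \<le> L"
      using norm_cell_le[OF that(3)] L(1)[OF that(2)] by simp
    finally show ?thesis
      using \<open>d > 0\<close> by (simp add: field_simps)
  qed
  \<comment> \<open>Take the cell w that contains y and let c represent the class of w - v d; then x
    = w - c lies in the coset v d + T and owns this cell.\<close>
  have ex_cell: "\<exists>x c. x - v d \<in> T \<and> c \<in> R \<and> y \<in> cell (real d) (x + c)" for d y
  proof -
    define w :: "int ^ 'n" where "w = (\<chi> i. \<lfloor>real d * y $ i\<rfloor>)"
    obtain c where "c \<in> R" "w - v d - c \<in> T"
      using transversal[of "w - v d"] by auto
    then show ?thesis
      by (intro exI[of _ "w - c"] exI[of _ c]) (auto simp: cell_def w_def algebra_simps)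
  qed
  have g_eq: "g d y = (if x \<in> X d then f (?p d x) else 0)"
    if "d > 0" "x - v d \<in> T" "c \<in> R" "y \<in> cell (real d) (x + c)" for d x c y
  proof -
    \<comment> \<open>Both index pairs name the cell of y, so x' + c' = x + c. Subtracting v d shows
      that c and c' represent the same class of T, hence agree; this collapses the double sum in
      \<open>g\<close> to at most one term.\<close>
    have uniq: "x' = x \<and> c' = c" if "x' \<in> X d" "c' \<in> R" "y \<in> cell (real d) (x' + c')" for x' c'
    proof -
      have "x' + c' = x + c"
        using that \<open>y \<in> cell (real d) (x + c)\<close> by (auto simp: cell_def vec_eq_iff)
      moreover from this have "x + c - v d - c' = x' - v d" "x + c - v d - c = x - v d"
        by (simp_all add: algebra_simps)
      then have "c' = c"
        using transversal[of "x + c - v d"] that(2) \<open>c \<in> R\<close> coset[OF that(1)] \<open>x - v d \<in> T\<close> by metis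
      ultimately show ?thesis by simp
    qed
    have "g d y = (\<Sum>x'\<in>X d. \<Sum>c'\<in>R. if x' = x then if c' = c then f (?p d x) else 0 else 0)"
      unfolding g_def
    proof (intro sum.cong refl)
      fix x' c' assume "x' \<in> X d" "c' \<in> R"
      then show "f (?p d x') * indicator (cell (real d) (x' + c')) y =
          (if x' = x then if c' = c then f (?p d x) else 0 else 0)"
        using uniq[of x' c'] that(4) by (cases "y \<in> cell (real d) (x' + c')") auto
    qed
    also have "\<dots> = (\<Sum>x'\<in>X d. if x' = x then f (?p d x) else 0)"
      using \<open>finite R\<close> \<open>c \<in> R\<close> by (intro sum.cong) simp_all
    finally show ?thesis
      using finX[OF \<open>d > 0\<close>] by simp
  qed
  \<comment> \<open>Each x contributes one cell of volume 1/d^n for every c in \<open>R\<close>;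
    this is where the factor \<open>card R\<close>, the later index of T, comes from.\<close>
  have g_integral: "(g d has_integral real (card R) * ((\<Sum>x\<in>X d. f (?p d x)) / real d ^ CARD('n))) UNIV"
    if "d > 0" for d
  proof -
    have "(g d has_integral (\<Sum>x\<in>X d. \<Sum>c\<in>R. f (?p d x) * (1 / real d ^ CARD('n)))) UNIV"
      unfolding g_def using that \<open>finite R\<close> finX
      by (intro has_integral_sum has_integral_mult_right has_integral_indicator_cell) auto
    then show ?thesis
      by (simp add: sum_distrib_left sum_divide_distrib)
  qed
  obtain B where B: "\<And>y. y \<in> K \<Longrightarrow> \<bar>f y\<bar> \<le> B"
  proof -
    have "compact (f ` K)"
      using contf \<open>compact K\<close> by (intro compact_continuous_image) (auto intro: continuous_on_subset)
    then obtain B where "\<forall>y\<in>f ` K. norm y \<le> B"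
      using compact_imp_bounded bounded_iff by blast
    then show ?thesis
      using that[of B] by auto
  qed
  obtain D where D: "\<And>y. y \<in> K \<Longrightarrow> norm y \<le> D"
    using \<open>bounded K\<close> by (auto simp: bounded_iff)
  \<comment> \<open>For d \<ge> 1 a cell owned by a point of X d lies within L/d \<le> L of
    \<open>K\<close>, so one box contains the supports of all these step functions.\<close>
  obtain a b :: "real ^ 'n" where ab: "cball 0 (D + L) \<subseteq> cbox a b"
    using bounded_subset_cbox_symmetric[OF bounded_cball] by blast
  \<comment> \<open>The integrable majorant. The absolute value keeps \<open>h\<close> nonnegative
    even if \<open>K\<close> is empty, when \<open>B\<close> may be negative.\<close>
  define h where "h y = (if y \<in> cbox a b then \<bar>B\<bar> else 0)" for y
  \<comment> \<open>Pointwise convergence is proved only off the frontier; this removes a negligible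
    set and changes no integral.\<close>
  let ?S = "- frontier K"
  have "card R \<noteq> 0"
    using transversal \<open>finite R\<close> by auto
  have "(\<lambda>d. integral ?S (g (Suc d))) \<longlonglongrightarrow> integral ?S (\<lambda>y. if y \<in> K then f y else 0)"
  proof (rule dominated_convergence(2))
    have spike: "negligible {x \<in> UNIV - ?S. F x \<noteq> 0}" "negligible {x \<in> ?S - UNIV. F x \<noteq> 0}" for F :: "real ^ 'n \<Rightarrow> real"
      using negl by (auto intro: negligible_subset)
    show "g (Suc d) integrable_on ?S" for d
      using g_integral[of "Suc d"] integrable_spike_set[OF _ spike] by blast
    have "h integrable_on UNIV"
      unfolding h_def integrable_restrict_UNIV by (rule integrable_const)
    then show "h integrable_on ?S"
      using integrable_spike_set[OF _ spike] by blast
  next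
    fix d y
    obtain x c where xc: "x - v (Suc d) \<in> T" "c \<in> R" "y \<in> cell (real (Suc d)) (x + c)"
      using ex_cell by blast
    show "norm (g (Suc d) y) \<le> h y"
    proof (cases "x \<in> X (Suc d)")
      case True
      have "?p (Suc d) x \<in> K"
        using inK[OF _ True] by simp
      moreover have "dist (?p (Suc d) x) y \<le> L / real (Suc d)"
        using near[OF _ xc(2,3)] by simp
      moreover have "L / real (Suc d) \<le> L / 1"
        using L(2) by (intro divide_left_mono) auto
      ultimately have "norm y \<le> D + L" "\<bar>f (?p (Suc d) x)\<bar> \<le> \<bar>B\<bar>"
        using D[of "?p (Suc d) x"] B[of "?p (Suc d) x"] norm_triangle_sub[of y "?p (Suc d) x"]
        by (auto simp: dist_norm norm_minus_commute)
      moreover from this have "y \<in> cbox a b"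
        using ab by (auto simp: subset_iff)
      ultimately show ?thesis
        using g_eq[OF _ xc] True by (simp add: h_def)
    qed (use g_eq[OF _ xc] in \<open>simp add: h_def\<close>)
  next
    fix y assume y: "y \<in> ?S"
    have "\<forall>d. \<exists>x c. x - v d \<in> T \<and> c \<in> R \<and> y \<in> cell (real d) (x + c)"
      using ex_cell by blast
    \<comment> \<open>Follow y through the cells: x d is the owner of the cell of y at scale d, and
      x d / d tends to y by \<open>near\<close>.\<close>
    then obtain x c where xc: "\<And>d. x d - v d \<in> T" "\<And>d. c d \<in> R" "\<And>d. y \<in> cell (real d) (x d + c d)"
      by metis
    have gx: "g d y = (if x d \<in> X d then f (?p d (x d)) else 0)" if "d > 0" for d
      using g_eq[OF that xc] .
    have "(\<lambda>d. L / real d) \<longlonglongrightarrow> 0"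
      by (rule lim_const_over_n)
    then have "(\<lambda>d. dist (?p d (x d)) y) \<longlonglongrightarrow> 0"
      by (rule Lim_null_comparison[rotated])
         (auto intro!: eventually_mono[OF eventually_gt_at_top[of 0]] near xc)
    then have lim: "(\<lambda>d. ?p d (x d)) \<longlonglongrightarrow> y"
      using tendsto_dist_iff by blast
    have "(\<lambda>d. g d y) \<longlonglongrightarrow> (if y \<in> K then f y else 0)"
    proof (cases "y \<in> K")
      case True
      \<comment> \<open>Off the frontier, membership in \<open>K\<close> means interior, so
        \<open>fills\<close> eventually puts x d into X d and g d y becomes f(x d / d), which tends
        to f y by continuity.\<close>
      then have "y \<in> interior K"
        using y closure_subset by (auto simp: frontier_def)
      then obtain \<epsilon> where "\<epsilon> > 0"
        and \<epsilon>: "\<forall>\<^sub>F d in sequentially. \<forall>x. x - v d \<in> T \<and> dist (?p d x) y < \<epsilon> \<longrightarrow> x \<in> X d"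
        using fills by blast
      have "\<forall>\<^sub>F d in sequentially. f (?p d (x d)) = g d y"
        using \<epsilon> tendstoD[OF lim \<open>\<epsilon> > 0\<close>] eventually_gt_at_top[of 0]
        by eventually_elim (use gx xc in auto)
      moreover have "(\<lambda>d. f (?p d (x d))) \<longlonglongrightarrow> f y"
        using contf lim by (auto intro: continuous_on_tendsto_compose)
      ultimately show ?thesis
        using True Lim_transform_eventually by fastforce
    next
      case False
      \<comment> \<open>The complement of \<open>K\<close> is open, so x d / d eventually leaves
        \<open>K\<close>; by \<open>inK\<close> the point x d is then not in X d.\<close>
      then have "\<forall>\<^sub>F d in sequentially. ?p d (x d) \<in> - K"
        using lim \<open>closed K\<close> by (intro topological_tendstoD) auto
      then have "\<forall>\<^sub>F d in sequentially. g d y = 0"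
        using eventually_gt_at_top[of 0] by eventually_elim (use gx inK in auto)
      then show ?thesis
        using False by (simp add: tendsto_eventually)
    qed
    then show "(\<lambda>d. g (Suc d) y) \<longlonglongrightarrow> (if y \<in> K then f y else 0)"
      by (rule LIMSEQ_Suc)
  qed
  moreover have restrict: "integral ?S F = integral UNIV F" for F :: "real ^ 'n \<Rightarrow> real"
    using negl by (intro integral_spike_set) (auto intro: negligible_subset)
  ultimately have "(\<lambda>d. integral UNIV (g (Suc d))) \<longlonglongrightarrow> integral K f"
    by (simp add: integral_restrict_UNIV)
  then have "(\<lambda>d. integral UNIV (g d)) \<longlonglongrightarrow> integral K f"
    by (rule LIMSEQ_imp_Suc)
  then have "(\<lambda>d. 1 / real (card R) * integral UNIV (g d)) \<longlonglongrightarrow> 1 / real (card R) * integral K f"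
    by (rule tendsto_mult_left)
  moreover have "\<forall>\<^sub>F d in sequentially. 1 / real (card R) * integral UNIV (g d)
      = (\<Sum>x\<in>X d. f (?p d x)) / real d ^ CARD('n)"
    using eventually_gt_at_top[of 0]
    by eventually_elim (use \<open>card R \<noteq> 0\<close> in \<open>simp add: integral_unique[OF g_integral]\<close>)
  ultimately show ?thesis
    by (rule Lim_transform_eventually)
qed

section \<open>Coset representatives of a subgroup of finite index\<close>

text \<open>Choosing one element from each coset gives \<open>R\<close>. Distinct cosets are
  disjoint, so the choice is injective and \<open>R\<close> has as many elements as there are
  cosets.\<close>

lemma finite_index_transversal:
  fixes T :: "(int ^ 'n) set"
  assumes "finite_index_subgroup T"
  obtains R where "finite R" "card R = ind T" "\<And>w. \<exists>!c. c \<in> R \<and> w - c \<in> T"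
proof -
  interpret comm_group "lattice_group :: (int ^ 'n) monoid"
    by (rule comm_group_lattice_group)
  have T: "subgroup T lattice_group" and fin: "finite (rcosets\<^bsub>lattice_group\<^esub> T)"
    using assms by (auto simp: finite_index_subgroup_def)
  have T0: "0 \<in> T" and Tadd: "\<And>x y. x \<in> T \<Longrightarrow> y \<in> T \<Longrightarrow> x + y \<in> T"
    using subgroup.one_closed[OF T] subgroup.m_closed[OF T] by (auto simp: lattice_group_def)
  have inv: "inv\<^bsub>lattice_group\<^esub> x = - x" for x :: "int ^ 'n"
    by (rule inv_equality) (auto simp: lattice_group_def)
  have Tminus: "- x \<in> T" if "x \<in> T" for x
    using subgroup.m_inv_closed[OF T that] by (simp add: inv)
  have Tdiff: "x - y \<in> T" if "x \<in> T" "y \<in> T" for x y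
    using Tadd[OF that(1) Tminus[OF that(2)]] by simp
  \<comment> \<open>The coset w + T, written as a membership condition on differences.\<close>
  define Q where "Q w = {x. x - w \<in> T}" for w
  have Q: "rcosets\<^bsub>lattice_group\<^esub> T = range Q"
  proof -
    have "T #>\<^bsub>lattice_group\<^esub> w = Q w" for w
      by (force simp: r_coset_def lattice_group_def Q_def intro: exI[of _ "_ - w"])
    then show ?thesis
      by (auto simp: RCOSETS_def lattice_group_def)
  qed
  have Q_eq: "Q w = Q w'" if "w - w' \<in> T" for w w'
    using Tadd[OF _ that] Tdiff[OF _ that] by (fastforce simp: Q_def algebra_simps)
  define rep where "rep S = (SOME x. x \<in> S)" for S :: "(int ^ 'n) set"
  have rep: "rep (Q w) - w \<in> T" for w
  proof -
    have "w \<in> Q w" using T0 by (simp add: Q_def)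
    then have "rep (Q w) \<in> Q w" unfolding rep_def by (rule someI)
    then show ?thesis by (simp add: Q_def)
  qed
  have Q_rep: "Q (rep (Q w)) = Q w" for w
    using Q_eq[OF rep] .
  show ?thesis
  proof
    show "finite (rep ` range Q)"
      using fin Q by simp
    \<comment> \<open>A coset is recovered from its representative: \<open>Q\<close> is a left
      inverse of \<open>rep\<close> on cosets.\<close>
    have "inj_on rep (range Q)"
      by (rule inj_on_inverseI[of _ Q]) (auto simp: Q_rep)
    then show "card (rep ` range Q) = ind T"
      by (simp add: ind_def Q card_image)
    fix w
    show "\<exists>!c. c \<in> rep ` range Q \<and> w - c \<in> T"
    proof (rule ex1I[of _ "rep (Q w)"])
      show "rep (Q w) \<in> rep ` range Q \<and> w - rep (Q w) \<in> T"
        using Tminus[OF rep[of w]] by simp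
      fix c assume "c \<in> rep ` range Q \<and> w - c \<in> T"
      then show "c = rep (Q w)"
        using Q_eq[of w c] Q_rep by auto
    qed
  qed
qed

section \<open>Sections of a positive cone\<close>

lemma cone_slice_scale:
  fixes C :: "(real \<times> 'a::real_vector) set"
  assumes "cone C" "d > 0"
  shows "x \<in> slice C d \<longleftrightarrow> (1 / d) *\<^sub>R x \<in> slice C 1"
proof
  assume "x \<in> slice C d"
  then show "(1 / d) *\<^sub>R x \<in> slice C 1"
    using mem_cone[OF assms(1), of "(d, x)" "1 / d"] assms(2) by (simp add: slice_def)
next
  assume "(1 / d) *\<^sub>R x \<in> slice C 1"
  then show "x \<in> slice C d"
    using mem_cone[OF assms(1), of "(1, (1 / d) *\<^sub>R x)" d] assms(2) by (simp add: slice_def)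
qed

lemma cone_slice_eq:
  fixes C :: "(real \<times> 'a::real_vector) set"
  assumes "cone C" "d > 0"
  shows "slice C d = (\<lambda>x. d *\<^sub>R x) ` slice C 1"
proof -
  have "x \<in> (\<lambda>x. d *\<^sub>R x) ` slice C 1 \<longleftrightarrow> (1 / d) *\<^sub>R x \<in> slice C 1" for x
    using assms(2) by (auto intro!: image_eqI[where x = "(1 / d) *\<^sub>R x"])
  then show ?thesis
    using cone_slice_scale[OF assms] by blast
qed

text \<open>Boundedness comes from compactness of the unit vectors of \<open>C\<close>: their height
  is never 0, hence is at least some m > 0. Normalizing (1, x) gives height 1 / norm (1, x) \<ge> m,
  so norm x \<le> 1/m.\<close>

lemma newton_body_compact_convex:
  assumes "positive_cone (C :: (real \<times> (real ^ 'n)) set)"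
  shows "compact (newton_body C)" "convex (newton_body C)"
proof -
  have C: "closed C" "convex C" "cone C" "\<And>z. z \<in> C \<Longrightarrow> fst z \<ge> 0" "C \<inter> {z. fst z = 0} = {0}"
    using assms by (auto simp: positive_cone_def)
  have vimage: "newton_body C = (\<lambda>x. (1, x)) -` C"
    by (auto simp: newton_body_def slice_def)
  have "closed (newton_body C)"
    unfolding vimage using C(1) by (intro closed_vimage continuous_intros)
  moreover have "bounded (newton_body C)"
  proof -
    have "compact (C \<inter> sphere 0 1)"
      using C(1) by (intro closed_Int_compact) auto
    then have "compact (fst ` (C \<inter> sphere 0 1))"
      by (intro compact_continuous_image continuous_intros)
    moreover have "0 \<notin> fst ` (C \<inter> sphere 0 1)"
    proof
      assume "0 \<in> fst ` (C \<inter> sphere 0 1)"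
      then obtain z where "z \<in> C \<inter> {z. fst z = 0}" "norm z = 1"
        by auto
      then show False unfolding C(5) by simp
    qed
    ultimately obtain m where m: "m > 0" "\<And>z. z \<in> C \<inter> sphere 0 1 \<Longrightarrow> m \<le> dist 0 (fst z)"
      using separate_point_closed[of "fst ` (C \<inter> sphere 0 1)" 0] compact_imp_closed by blast
    have "norm x \<le> 1 / m" if "x \<in> newton_body C" for x
    proof -
      let ?z = "(1 :: real, x)"
      have "norm ?z > 0" by (simp add: prod_eq_iff)
      have "(1 / norm ?z) *\<^sub>R ?z \<in> C"
        using that mem_cone[OF C(3), of ?z "1 / norm ?z"] vimage by simp
      moreover have "norm ((1 / norm ?z) *\<^sub>R ?z) = 1"
        unfolding norm_scaleR using \<open>norm ?z > 0\<close> by simp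
      ultimately have "(1 / norm ?z) *\<^sub>R ?z \<in> C \<inter> sphere 0 1"
        by (simp only: Int_iff mem_sphere_0)
      from m(2)[OF this] have "m \<le> 1 / norm ?z"
        using \<open>norm ?z > 0\<close> by simp
      then have "norm ?z \<le> 1 / m"
        using \<open>norm ?z > 0\<close> m(1) by (simp add: field_simps)
      moreover have "norm x \<le> norm ?z"
        using norm_snd_le[of x 1] by simp
      ultimately show ?thesis by simp
    qed
    then show ?thesis by (auto simp: bounded_iff)
  qed
  ultimately show "compact (newton_body C)"
    by (simp add: compact_eq_bounded_closed)
  have "u *\<^sub>R x + v *\<^sub>R y \<in> newton_body C"
    if "x \<in> newton_body C" "y \<in> newton_body C" "u \<ge> 0" "v \<ge> 0" "u + v = 1" for x y u v
    using convexD[OF C(2), of "(1, x)" "(1, y)" u v] that by (simp add: vimage)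
  then show "convex (newton_body C)"
    by (simp add: convex_def)
qed

lemma bounded_slice:
  assumes "positive_cone (C :: (real \<times> (real ^ 'n)) set)" "d > 0"
  shows "bounded (slice C d)"
proof -
  have "slice C d = (\<lambda>x. d *\<^sub>R x) ` newton_body C"
    using assms by (auto simp: positive_cone_def newton_body_def intro!: cone_slice_eq)
  then show ?thesis
    using newton_body_compact_convex(1)[OF assms(1)] by (metis bounded_scaling compact_imp_bounded)
qed

text \<open>Scaled by d, the ball about y becomes a ball of radius d \<delta> about d y inside the
  slice. Half of this radius is spent on reaching x from d y; the other half keeps x away from the
  frontier.\<close>

lemma infdist_frontier_slice_ge:
  fixes C :: "(real \<times> (real ^ 'n)) set"
  assumes "positive_cone C" "d > 0" "ball y \<delta> \<subseteq> newton_body C" "dist ((1 / d) *\<^sub>R x) y < \<delta> / 2"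
  shows "d * (\<delta> / 2) \<le> infdist x (frontier (slice C d))"
proof -
  let ?K = "newton_body C"
  have slice: "slice C d = (\<lambda>x. d *\<^sub>R x) ` ?K"
    using assms(1,2) by (auto simp: positive_cone_def newton_body_def intro!: cone_slice_eq)
  have scale: "dist (d *\<^sub>R p) (d *\<^sub>R q) = d * dist p q" for p q :: "real ^ 'n"
    using \<open>d > 0\<close> by (simp add: dist_norm flip: scaleR_diff_right)
  have "0 < \<delta>"
    using assms(4) zero_le_dist[of "(1 / d) *\<^sub>R x" y] by linarith
  then have "y \<in> ?K" using assms(3) by auto
  have "bounded (slice C d)"
    using assms(1,2) by (rule bounded_slice)
  \<comment> \<open>\<open>infdist\<close> to the empty set is 0 by convention, so the frontier has
    to be non-empty. It is, since the slice is neither empty nor, being bounded, the whole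
    space.\<close>
  then have "frontier (slice C d) \<noteq> {}"
    using \<open>y \<in> ?K\<close> slice not_bounded_UNIV by (auto simp: frontier_eq_empty)
  moreover have "d * (\<delta> / 2) \<le> dist x q" if "q \<in> frontier (slice C d)" for q
  proof (rule ccontr)
    assume *: "\<not> d * (\<delta> / 2) \<le> dist x q"
    have sub: "ball (d *\<^sub>R y) (d * \<delta>) \<subseteq> slice C d"
    proof
      fix u assume "u \<in> ball (d *\<^sub>R y) (d * \<delta>)"
      moreover have "dist (d *\<^sub>R y) u = d * dist y ((1 / d) *\<^sub>R u)"
        using scale[of y "(1 / d) *\<^sub>R u"] \<open>d > 0\<close> by simp
      ultimately have "(1 / d) *\<^sub>R u \<in> ?K"
        using assms(3) \<open>d > 0\<close> by auto
      then show "u \<in> slice C d"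
        using \<open>d > 0\<close> by (auto simp: slice intro!: image_eqI[where x = "(1 / d) *\<^sub>R u"])
    qed
    have "dist x (d *\<^sub>R y) = d * dist ((1 / d) *\<^sub>R x) y"
      using scale[of "(1 / d) *\<^sub>R x" y] \<open>d > 0\<close> by simp
    then have "dist x (d *\<^sub>R y) < d * (\<delta> / 2)"
      using assms(4) \<open>d > 0\<close> by simp
    then have "q \<in> ball (d *\<^sub>R y) (d * \<delta>)"
      using * dist_triangle[of "d *\<^sub>R y" q x] by (simp add: dist_commute)
    \<comment> \<open>The open ball lies in the slice, hence in its interior, where no frontier
      point can be.\<close>
    then have "q \<in> interior (slice C d)"
      using sub by (meson interior_maximal Elementary_Metric_Spaces.open_ball subsetD)
    then show False using that by (simp add: frontier_def)
  qed
  ultimately show ?thesis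
    unfolding infdist_def by (simp only: if_False) (rule cINF_greatest)
qed

section \<open>Approximated semigroups and the limit\<close>

text \<open>Since \<open>A\<close> has degree 1 and elements of T have degree 0, degree d forces the
  coefficient l = d; the slice is thus cut out of a single coset of T.\<close>

lemma slice_type_semigroup:
  assumes "fst A = 1"
  shows "x \<in> slice (type_semigroup C T A) (int d) \<longleftrightarrow>
    vec_real x \<in> slice C (real d) \<and> x - int d *s snd A \<in> T"
  using assms by (auto simp: slice_def type_semigroup_def algebra_simps intro!: bexI[of _ "x - int d *s snd A"])

theorem theorem3p25:
  fixes G :: "(int \<times> (int ^ 'n)) set"
    and C :: "(real \<times> (real ^ 'n)) set"
    and T :: "(int ^ 'n) set"
    and A :: "int \<times> (int ^ 'n)"
    and f :: "real ^ 'n \<Rightarrow> real"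
    and \<alpha> :: real
  assumes "graded_semigroup G"
    and "approximated_by_type G C T A"
    and "\<alpha> \<ge> 0"
    and "C1_function f"
    and "homogeneous_of_degree \<alpha> f"
  shows "(\<lambda>d. (\<Sum>x\<in>slice G (int d). f (vec_real x)) / real d powr (\<alpha> + real CARD('n)))
           \<longlonglongrightarrow> 1 / real (ind T) * integral (newton_body C) f"
proof -
  let ?M = "type_semigroup C T A"
  have C: "positive_cone C" and T: "finite_index_subgroup T" and A: "fst A = 1" and GM: "G \<subseteq> ?M"
    and defect: "(\<lambda>d. approx_defect C ?M G d / real d) \<longlonglongrightarrow> 0"
    using assms(2) by (auto simp: approximated_by_type_def)
  note K = newton_body_compact_convex[OF C]
  have scale: "vec_real x \<in> slice C (real d) \<longleftrightarrow> (1 / real d) *\<^sub>R vec_real x \<in> newton_body C"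
    if "d > 0" for d and x :: "int ^ 'n"
    using C that cone_slice_scale[of C "real d"] by (simp add: newton_body_def positive_cone_def)
  have inC: "vec_real x \<in> slice C (real d)" and coset: "x - int d *s snd A \<in> T"
    if "x \<in> slice G (int d)" for x d
  proof -
    have "x \<in> slice ?M (int d)"
      using GM that by (auto simp: slice_def)
    then show "vec_real x \<in> slice C (real d)" "x - int d *s snd A \<in> T"
      by (simp_all add: slice_type_semigroup[OF A])
  qed
  obtain R where R: "finite R" "card R = ind T" "\<And>w. \<exists>!c. c \<in> R \<and> w - c \<in> T"
    using finite_index_transversal[OF T] by blast
  have "continuous_on UNIV f"
    using assms(4) by (auto simp: C1_function_def continuous_on_eq_continuous_within
        intro: has_derivative_continuous)
  moreover have "negligible (frontier (newton_body C))"
    using K(2) by (rule negligible_convex_frontier)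
  \<comment> \<open>The hypothesis \<open>fills\<close>: a point x of the coset with x/d near y lies
    in M(d). Were it missing from G(d), its distance d \<delta>/2 or more to the frontier would be a
    lower bound for the defect, which is eventually less than d \<delta>/2.\<close>
  moreover have "\<exists>\<epsilon>>0. \<forall>\<^sub>F d in sequentially. \<forall>x. x - int d *s snd A \<in> T \<and>
      dist ((1 / real d) *\<^sub>R vec_real x) y < \<epsilon> \<longrightarrow> x \<in> slice G (int d)"
    if y: "y \<in> interior (newton_body C)" for y
  proof -
    obtain \<delta> where \<delta>: "\<delta> > 0" "ball y \<delta> \<subseteq> newton_body C"
      using y[unfolded mem_interior] by blast
    have "\<forall>\<^sub>F d in sequentially. approx_defect C ?M G d / real d < \<delta> / 2"
      using \<delta>(1) by (intro order_tendstoD(2)[OF defect]) simp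
    then have "\<forall>\<^sub>F d in sequentially. \<forall>x. x - int d *s snd A \<in> T \<and>
      dist ((1 / real d) *\<^sub>R vec_real x) y < \<delta> / 2 \<longrightarrow> x \<in> slice G (int d)"
      using eventually_gt_at_top[of 0]
    proof eventually_elim
      case (elim d)
      show ?case
      proof (intro allI impI, rule ccontr)
        fix x :: "int ^ 'n"
        let ?W = "slice ?M (int d) - slice G (int d)"
        assume x: "x - int d *s snd A \<in> T \<and> dist ((1 / real d) *\<^sub>R vec_real x) y < \<delta> / 2"
          and "x \<notin> slice G (int d)"
        have "(1 / real d) *\<^sub>R vec_real x \<in> ball y \<delta>"
          using x \<delta>(1) by (simp add: dist_commute)
        then have "x \<in> slice ?M (int d)"
          using x \<delta>(2) scale[OF elim(2)] by (auto simp: slice_type_semigroup[OF A])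
        with \<open>x \<notin> slice G (int d)\<close> have "x \<in> ?W" by simp
        have "bounded (slice C (real d))"
          using bounded_slice[OF C] elim(2) by simp
        \<comment> \<open>Finiteness makes \<open>Max\<close> in \<open>approx_defect\<close> an
          upper bound for the distance at x.\<close>
        then have "finite ?W"
          by (rule finite_subset[OF _ finite_bounded_vec_real, rotated])
             (auto simp: slice_type_semigroup[OF A])
        then have "infdist (vec_real x) (frontier (slice C (real d))) \<le> approx_defect C ?M G d"
          using \<open>x \<in> ?W\<close> by (auto simp: approx_defect_def)
        moreover have "real d * (\<delta> / 2) \<le> infdist (vec_real x) (frontier (slice C (real d)))"
          using infdist_frontier_slice_ge[OF C _ \<delta>(2)] x elim(2) by auto
        ultimately show False
          using elim by (simp add: field_simps)
      qed
    qed
    then show ?thesis using \<delta>(1) by (intro exI[of _ "\<delta> / 2"]) simp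
  qed
  ultimately have "(\<lambda>d. (\<Sum>x\<in>slice G (int d). f ((1 / real d) *\<^sub>R vec_real x)) / real d ^ CARD('n))
           \<longlonglongrightarrow> 1 / real (card R) * integral (newton_body C) f"
    using K(1) R(1,3) coset inC scale
    by (intro lattice_sum_tendsto_integral[where v = "\<lambda>d. int d *s snd A" and T = T]) blast+
  moreover have "\<forall>\<^sub>F d in sequentially.
      (\<Sum>x\<in>slice G (int d). f ((1 / real d) *\<^sub>R vec_real x)) / real d ^ CARD('n) =
      (\<Sum>x\<in>slice G (int d). f (vec_real x)) / real d powr (\<alpha> + real CARD('n))"
    using eventually_gt_at_top[of 0]
  proof eventually_elim
    case (elim d)
    \<comment> \<open>Homogeneity with factor 1/d moves the scaling out of \<open>f\<close>; the
      resulting d powr \<alpha> joins the cell volume factor d^n in the denominator.\<close>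
    have "f ((1 / real d) *\<^sub>R vec_real x) = f (vec_real x) / real d powr \<alpha>" for x :: "int ^ 'n"
    proof -
      have "f ((1 / real d) *\<^sub>R vec_real x) = (1 / real d) powr \<alpha> * f (vec_real x)"
        using assms(5) elim unfolding homogeneous_of_degree_def
        by (metis of_nat_0_less_iff zero_less_divide_1_iff)
      then show ?thesis
        by (simp add: powr_divide)
    qed
    then show ?case
      using elim by (simp add: sum_divide_distrib powr_add powr_realpow)
  qed
  ultimately show ?thesis
    unfolding R(2) by (rule Lim_transform_eventually)
qed

end
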